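(* Let $DEFGH$ be a regular pentagon with sides of length $1$, and let the side $DE$ be reflected about the chord line $HF$ to form the line segment $ST$. Let $\Delta ABC$ be a triangle which encloses the pentagon, subject to the following conditions: the side $DE$ is on the side $AB$ of the triangle, there are no obtuse angles on $AB$ (i.e. the angles at $A$ and $B$ are not obtuse), the vertex $F$ is on $BC$, the vertex $H$ is on $CA$, and the vertex $C$ is on the segment $ST$. Then $\Delta ABC$ is a minimum enclosing triangle of the pentagon, i.e. its area is the smallest among all triangles enclosing the pentagon, and its area is $(ABC) = \sqrt{5+2\sqrt{5}}$.
   Context: The vertices $D,E,F,G,H$ of the pentagon are labeled in cyclic order. A triangle encloses the pentagon if the (filled) pentagon is contained in the (filled) triangle, at least four of the five vertices of the pentagon lie on the sides of the triangle, a side of the pentagon lies on one side of the triangle (called the base), and the two angles of the triangle at the endpoints of the base are not obtuse. $(ABC)$ denotes the area of $\Delta ABC$. *)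

theory Defs
  imports "HOL-Analysis.Analysis"
begin

definition vertex_angle :: "real^2 \<Rightarrow> real^2 \<Rightarrow> real^2 \<Rightarrow> real" where
  "vertex_angle X Y Z = arccos (((X - Y) \<bullet> (Z - Y)) / (norm (X - Y) * norm (Z - Y)))"

text \<open>A regular pentagon is a convex pentagon, with vertices listed in cyclic order, that is
  equilateral and equiangular. Convexity together with the cyclic order is expressed by requiring
  the segments between cyclically consecutive vertices to be edges of the convex hull; this
  excludes the regular pentagram.\<close>

definition regular_pentagon ::
  "real^2 \<Rightarrow> real^2 \<Rightarrow> real^2 \<Rightarrow> real^2 \<Rightarrow> real^2 \<Rightarrow> bool" where
  "regular_pentagon D E F G H \<longleftrightarrow>
     distinct [D, E, F, G, H] \<and>
     (\<forall>(X, Y) \<in> {(D, E), (E, F), (F, G), (G, H), (H, D)}.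
        closed_segment X Y edge_of convex hull {D, E, F, G, H} \<and> dist X Y = dist D E) \<and>
     (\<forall>(X, Y, Z) \<in> {(D, E, F), (E, F, G), (F, G, H), (G, H, D), (H, D, E)}.
        vertex_angle X Y Z = vertex_angle D E F)"

definition reflect_line :: "real^2 \<Rightarrow> real^2 \<Rightarrow> real^2 \<Rightarrow> real^2" where
  "reflect_line P Q X = 2 *\<^sub>R closest_point (affine hull {P, Q}) X - X"

definition triangle_area :: "real^2 \<Rightarrow> real^2 \<Rightarrow> real^2 \<Rightarrow> real" where
  "triangle_area A B C = measure lborel (convex hull {A, B, C})"

text \<open>Any of the three sides of the triangle may serve as the base \<open>PQ\<close>, and any of the
  five sides of the pentagon may be the one lying on it.\<close>

definition encloses ::
  "real^2 \<Rightarrow> real^2 \<Rightarrow> real^2 \<Rightarrow>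
   real^2 \<Rightarrow> real^2 \<Rightarrow> real^2 \<Rightarrow> real^2 \<Rightarrow> real^2 \<Rightarrow> bool" where
  "encloses A B C D E F G H \<longleftrightarrow>
     \<not> collinear {A, B, C} \<and>
     convex hull {D, E, F, G, H} \<subseteq> convex hull {A, B, C} \<and>
     card ({D, E, F, G, H} \<inter>
           (closed_segment A B \<union> closed_segment B C \<union> closed_segment C A)) \<ge> 4 \<and>
     (\<exists>(P, Q, R) \<in> {(A, B, C), (B, C, A), (C, A, B)}.
        (\<exists>(X, Y) \<in> {(D, E), (E, F), (F, G), (G, H), (H, D)}.
           closed_segment X Y \<subseteq> closed_segment P Q) \<and>
        vertex_angle R P Q \<le> pi / 2 \<and> vertex_angle P Q R \<le> pi / 2)"

definition minimum_enclosing_triangle ::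
  "real^2 \<Rightarrow> real^2 \<Rightarrow> real^2 \<Rightarrow>
   real^2 \<Rightarrow> real^2 \<Rightarrow> real^2 \<Rightarrow> real^2 \<Rightarrow> real^2 \<Rightarrow> bool" where
  "minimum_enclosing_triangle A B C D E F G H \<longleftrightarrow>
     encloses A B C D E F G H \<and>
     (\<forall>A' B' C'. encloses A' B' C' D E F G H \<longrightarrow>
        triangle_area A B C \<le> triangle_area A' B' C')"

end

theory Submission
  imports Defs
begin

text \<open>
  Only one comparison matters. Let \<open>PQR\<close> be a triangle with apex \<open>R\<close> at height \<open>k\<close> above
  the base \<open>PQ\<close>, and let \<open>HF\<close> be a segment in the triangle, parallel to the base, at height
  \<open>s\<close>. The width of the triangle at height \<open>s\<close> is at least \<open>\<bar>HF\<bar>\<close>, so its base has length at least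
  \<open>\<bar>HF\<bar> * k / (k - s)\<close>, and since \<open>k\<^sup>2 \<ge> 4 * s * (k - s)\<close> its area is at least
  \<open>2 * s * \<bar>HF\<bar>\<close> (\<open>triangle_area_ge_parallel_chord\<close>). Equality holds if \<open>k = 2 * s\<close> and
  \<open>H\<close>, \<open>F\<close> lie on the two other sides.

  In a regular pentagon with the side \<open>DE\<close> on the base, the diagonal \<open>HF\<close> is such a segment
  (\<open>unit_regular_pentagon\<close>), and by cyclic symmetry each side has its diagonal, of the same
  length and at the same distance. So every enclosing triangle satisfies the bound. A point of
  the reflected segment \<open>ST\<close> is twice as high above \<open>DE\<close> as the line \<open>HF\<close>, so a triangle with
  its apex there attains the bound (\<open>triangle_area_midsegment\<close>).

  All heights and areas are expressed by the bilinear area form of the plane, so no coordinate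
  system adapted to the pentagon is needed.
\<close>

section \<open>The area form of the plane\<close>

definition wedge :: "real^2 \<Rightarrow> real^2 \<Rightarrow> real" where
  "wedge u v = u$1 * v$2 - u$2 * v$1"

lemma wedge_simps:
  "wedge (u + u') v = wedge u v + wedge u' v"
  "wedge (u - u') v = wedge u v - wedge u' v"
  "wedge u (v + v') = wedge u v + wedge u v'"
  "wedge u (v - v') = wedge u v - wedge u v'"
  "wedge (r *\<^sub>R u) v = r * wedge u v"
  "wedge u (r *\<^sub>R v) = r * wedge u v"
  "wedge u u = 0"
  by (simp_all add: wedge_def algebra_simps)

lemma wedge_swap: "wedge v u = - wedge u v"
  by (simp add: wedge_def)

lemma inner_real2: "u \<bullet> v = u$1 * v$1 + u$2 * v$2" for u v :: "real^2"
  by (simp add: inner_vec_def sum_2)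

text \<open>For unit vectors the next three identities are the Pythagorean identity and the
  addition theorems for the cosine and the sine of the oriented angle.\<close>

lemma inner_wedge_pythagoras:
  "(u \<bullet> v)\<^sup>2 + (wedge u v)\<^sup>2 = (u \<bullet> u) * (v \<bullet> v)"
  by (simp add: wedge_def inner_real2 power2_eq_square algebra_simps)

lemma inner_angle_add:
  "(v \<bullet> v) * (u \<bullet> w) = (u \<bullet> v) * (v \<bullet> w) - wedge u v * wedge v w"
  by (simp add: wedge_def inner_real2 algebra_simps)

lemma wedge_angle_add:
  "(v \<bullet> v) * wedge u w = (u \<bullet> v) * wedge v w + wedge u v * (v \<bullet> w)"
  by (simp add: wedge_def inner_real2 algebra_simps)

text \<open>Turning a unit vector by opposite angles gives two vectors whose components orthogonal
  to it cancel.\<close>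

lemma opposite_turns_add:
  assumes "u \<bullet> u = 1" "v \<bullet> u = w \<bullet> u" "wedge u v = - wedge u w"
  shows "v + w = (2 * (v \<bullet> u)) *\<^sub>R u"
proof -
  have turn: "x $ 1 = (x \<bullet> u) * u$1 - wedge u x * u$2"
    "x $ 2 = (x \<bullet> u) * u$2 + wedge u x * u$1" for x
  proof -
    have "(x \<bullet> u) * u$1 - wedge u x * u$2 = (u \<bullet> u) * x$1"
      "(x \<bullet> u) * u$2 + wedge u x * u$1 = (u \<bullet> u) * x$2"
      by (simp_all add: wedge_def inner_real2 algebra_simps)
    with assms(1) show "x $ 1 = (x \<bullet> u) * u$1 - wedge u x * u$2"
      "x $ 2 = (x \<bullet> u) * u$2 + wedge u x * u$1" by simp_all
  qed
  show ?thesis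
    using turn[of v] turn[of w] assms(2,3) by (simp add: vec_eq_iff forall_2)
qed

lemma triangle_area_wedge: "triangle_area A B C = \<bar>wedge (B - A) (C - A)\<bar> / 2"
  unfolding triangle_area_def
  by (subst content_triangle) (simp add: wedge_def abs_minus_commute algebra_simps)

section \<open>Triangles containing a segment parallel to the base\<close>

lemma diff_on_segment:
  assumes "X \<in> closed_segment P Q" "Y \<in> closed_segment P Q"
  obtains t :: real where "Y - X = t *\<^sub>R (Q - P)"
proof -
  obtain a b where X: "X = (1 - a) *\<^sub>R P + a *\<^sub>R Q" and Y: "Y = (1 - b) *\<^sub>R P + b *\<^sub>R Q"
    using assms by (auto simp: closed_segment_def)
  have "Y - X = (b - a) *\<^sub>R (Q - P)"
    unfolding X Y by (simp add: algebra_simps)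
  then show ?thesis by (rule that)
qed

text \<open>If the triangle is not degenerate, the points of \<open>HF\<close> have the same barycentric
  coordinate \<open>\<tau>\<close> at the apex, which leaves at most \<open>1 - \<tau>\<close> for those at \<open>P\<close> and \<open>Q\<close>. The claim
  thus reduces to \<open>4 * \<tau> * (1 - \<tau>) \<le> 1\<close>.\<close>

lemma triangle_area_ge_parallel_chord:
  assumes "X \<in> closed_segment P Q"
    and F: "F \<in> convex hull {P, Q, R}" and H: "H \<in> convex hull {P, Q, R}"
    and par: "F - H = r *\<^sub>R (Q - P)"
  shows "2 * \<bar>wedge (F - H) (F - X)\<bar> \<le> triangle_area P Q R"
proof -
  define \<Delta> where "\<Delta> = wedge (Q - P) (R - P)"
  obtain f1 f2 \<tau> where f: "f1 \<ge> 0" "f2 \<ge> 0" "\<tau> \<ge> 0" "f1 + f2 + \<tau> = 1"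
      and Feq: "F = f1 *\<^sub>R P + f2 *\<^sub>R Q + \<tau> *\<^sub>R R"
    using F by (auto simp: convex_hull_3)
  obtain h1 h2 h3 where h: "h1 \<ge> 0" "h2 \<ge> 0" "h3 \<ge> 0" "h1 + h2 + h3 = 1"
      and Heq: "H = h1 *\<^sub>R P + h2 *\<^sub>R Q + h3 *\<^sub>R R"
    using H by (auto simp: convex_hull_3)
  obtain x where Xeq: "X = (1 - x) *\<^sub>R P + x *\<^sub>R Q"
    using assms(1) by (auto simp: closed_segment_def)
  have f1: "f1 = 1 - f2 - \<tau>" and h1: "h1 = 1 - h2 - h3"
    using f h by auto
  have diff: "F - H = (f2 - h2) *\<^sub>R (Q - P) + (\<tau> - h3) *\<^sub>R (R - P)"
    unfolding Feq Heq f1 h1 by (simp add: algebra_simps)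
  have FX: "F - X = (f2 - x) *\<^sub>R (Q - P) + \<tau> *\<^sub>R (R - P)"
    unfolding Feq Xeq f1 by (simp add: algebra_simps)
  have "wedge (Q - P) (F - H) = (\<tau> - h3) * \<Delta>"
    unfolding diff \<Delta>_def wedge_simps(3,6,7) by simp
  moreover have "wedge (Q - P) (F - H) = 0"
    unfolding par wedge_simps(6,7) by simp
  ultimately have same_height: "(\<tau> - h3) * \<Delta> = 0" by simp
  have "wedge (F - H) (F - X) = (f2 - h2) * \<tau> * \<Delta>"
  proof -
    have "wedge (F - H) (F - X) = (f2 - h2) * \<tau> * \<Delta> - ((\<tau> - h3) * \<Delta>) * (f2 - x)"
      unfolding diff FX \<Delta>_def wedge_simps(1,3,5-7) wedge_swap[of "R - P" "Q - P"]
      by (simp add: algebra_simps)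
    with same_height show ?thesis by simp
  qed
  moreover have "4 * \<bar>(f2 - h2) * \<tau> * \<Delta>\<bar> \<le> \<bar>\<Delta>\<bar>"
  proof (cases "\<Delta> = 0")
    case False
    then have "\<bar>f2 - h2\<bar> \<le> 1 - \<tau>" using same_height f h by auto
    then have "\<bar>f2 - h2\<bar> * \<tau> \<le> (1 - \<tau>) * \<tau>"
      using f(3) by (rule mult_right_mono)
    also have "\<dots> \<le> 1 / 4"
      using zero_le_power2[of "2 * \<tau> - 1"] by (simp add: power2_eq_square algebra_simps)
    finally have "\<bar>f2 - h2\<bar> * \<tau> * \<bar>\<Delta>\<bar> \<le> 1 / 4 * \<bar>\<Delta>\<bar>"
      by (rule mult_right_mono) simp
    then show ?thesis using f(3) by (simp add: abs_mult)
  qed simp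
  ultimately show ?thesis
    by (simp add: triangle_area_wedge \<Delta>_def[symmetric])
qed

text \<open>The case of equality: an apex twice as high as the chord \<open>HF\<close> makes \<open>H\<close> and \<open>F\<close> the
  midpoints of the legs.\<close>

lemma triangle_area_midsegment:
  assumes X: "X \<in> closed_segment A B"
    and F: "F \<in> closed_segment B C" and H: "H \<in> closed_segment C A"
    and par: "F - H = r *\<^sub>R (B - A)"
    and nz: "wedge (B - A) (F - X) \<noteq> 0"
    and apex: "wedge (B - A) (C - X) = 2 * wedge (B - A) (F - X)"
  shows "triangle_area A B C = 2 * \<bar>wedge (F - H) (F - X)\<bar>"
proof -
  obtain f where f: "F = (1 - f) *\<^sub>R B + f *\<^sub>R C"
    using F by (auto simp: closed_segment_def)
  obtain h where h: "H = (1 - h) *\<^sub>R C + h *\<^sub>R A"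
    using H by (auto simp: closed_segment_def)
  obtain x where x: "X = (1 - x) *\<^sub>R A + x *\<^sub>R B"
    using X by (auto simp: closed_segment_def)
  define \<Delta> where "\<Delta> = wedge (B - A) (C - A)"
  have CX: "C - X = - x *\<^sub>R (B - A) + (C - A)"
    unfolding x by (simp add: algebra_simps)
  have FX: "F - X = (1 - f - x) *\<^sub>R (B - A) + f *\<^sub>R (C - A)"
    unfolding f x by (simp add: algebra_simps)
  have FH: "F - H = (1 - f) *\<^sub>R (B - A) + (f - (1 - h)) *\<^sub>R (C - A)"
    unfolding f h by (simp add: algebra_simps)
  have hF: "wedge (B - A) (F - X) = f * \<Delta>"
    unfolding FX \<Delta>_def wedge_simps(3,6,7) by simp
  have "wedge (B - A) (C - X) = \<Delta>"
    unfolding CX \<Delta>_def wedge_simps(3,6,7) by simp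
  with apex hF nz have "f = 1 / 2" "\<Delta> \<noteq> 0" by auto
  have "wedge (B - A) (F - H) = (f - (1 - h)) * \<Delta>"
    unfolding FH \<Delta>_def wedge_simps(3,6,7) by simp
  moreover have "wedge (B - A) (F - H) = 0"
    unfolding par wedge_simps(6,7) by simp
  ultimately have "f - (1 - h) = 0" using \<open>\<Delta> \<noteq> 0\<close> by simp
  then have "F - H = (1 / 2) *\<^sub>R (B - A)"
    unfolding FH by (simp only: \<open>f = 1 / 2\<close>) simp
  then have "wedge (F - H) (F - X) = \<Delta> / 4"
    using hF \<open>f = 1 / 2\<close> by (simp only: wedge_simps(5))
  then show ?thesis
    by (simp add: triangle_area_wedge \<Delta>_def[symmetric])
qed

text \<open>Reflection doubles heights over any line parallel to the mirror: the foot of the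
  perpendicular is on the mirror, hence at the height of the mirror.\<close>

lemma wedge_reflect_line:
  assumes "F - H = r *\<^sub>R u"
  shows "wedge u (reflect_line H F X - Y) = 2 * wedge u (F - Y) - wedge u (X - Y)"
proof -
  define p where "p = closest_point (affine hull {H, F}) X"
  have "p \<in> affine hull {H, F}"
    unfolding p_def by (rule closest_point_in_set) auto
  then obtain a b where "a + b = 1" "p = a *\<^sub>R H + b *\<^sub>R F"
    by (auto simp: affine_hull_2)
  then have p: "p = F - a *\<^sub>R (F - H)"
    by (simp add: algebra_simps scaleR_add_left[symmetric])
  have "wedge u p = wedge u F"
    unfolding p assms wedge_simps(4,6,7) by simp
  then show ?thesis
    by (simp add: reflect_line_def p_def[symmetric] wedge_simps)

qed

section \<open>The shape of a regular pentagon\<close>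

lemma regular_pentagon_rotate:
  assumes "regular_pentagon D E F G H"
  shows "regular_pentagon E F G H D" "dist E F = dist D E"
proof -
  have "{E, F, G, H, D} = {D, E, F, G, H}" by auto
  with assms show "regular_pentagon E F G H D"
    unfolding regular_pentagon_def by auto
  show "dist E F = dist D E"
    using assms unfolding regular_pentagon_def by auto
qed

text \<open>A face of a polytope is cut out by a supporting line. If that line degenerates, the
  polytope is the segment itself and all the areas vanish.\<close>

lemma face_segment_same_side:
  fixes V :: "(real^2) set"
  assumes face: "closed_segment X Y face_of convex hull V" and "finite V"
    and "Z \<in> V" "W \<in> V"
  shows "0 \<le> wedge (Y - X) (Z - X) * wedge (Y - X) (W - X)"
proof -
  have "closed_segment X Y exposed_face_of convex hull V"
    using face \<open>finite V\<close>
    by (simp add: exposed_face_of_polyhedron polyhedron_convex_hull)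
  then obtain a b where sub: "convex hull V \<subseteq> {x. a \<bullet> x \<le> b}"
      and eq: "closed_segment X Y = convex hull V \<inter> {x. a \<bullet> x = b}"
    by (auto simp: exposed_face_of_def)
  have ZW: "Z \<in> convex hull V" "W \<in> convex hull V"
    using assms(3,4) by (auto intro: hull_inc)
  have "a \<bullet> X = b" "a \<bullet> Y = b" using eq ends_in_segment[of X Y] by blast+
  show ?thesis
  proof (cases "a = 0")
    case True
    with \<open>a \<bullet> X = b\<close> eq have "convex hull V = closed_segment X Y" by auto
    with ZW obtain t where "Z - X = t *\<^sub>R (Y - X)"
      by (metis diff_on_segment ends_in_segment(1))
    then show ?thesis by (simp only: wedge_simps(6,7))
  next
    case False
    have perp: "a \<bullet> (Y - X) = 0"
      using \<open>a \<bullet> X = b\<close> \<open>a \<bullet> Y = b\<close> by (simp add: inner_diff_right)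
    have "0 \<le> (a \<bullet> (Z - X)) * (a \<bullet> (W - X))"
      using sub ZW \<open>a \<bullet> X = b\<close> by (intro mult_nonpos_nonpos) (auto simp: inner_diff_right)
    then have "0 \<le> (wedge a (Y - X))\<^sup>2 * ((a \<bullet> (Z - X)) * (a \<bullet> (W - X)))"
      by simp
    also have "\<dots> = ((a \<bullet> a) * wedge (Y - X) (Z - X)) * ((a \<bullet> a) * wedge (Y - X) (W - X))"
      unfolding wedge_angle_add[of a "Y - X"]
      using perp by (simp only: inner_commute[of _ a] wedge_swap[of _ a])
        (simp add: power2_eq_square algebra_simps)
    also have "\<dots> = (a \<bullet> a)\<^sup>2 * (wedge (Y - X) (Z - X) * wedge (Y - X) (W - X))"
      by (simp add: power2_eq_square)
    finally show ?thesis
      using False by (simp add: zero_le_mult_iff)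
  qed
qed

lemma unit_vertex_angle_eq:
  assumes "vertex_angle X Y Z = vertex_angle X' Y' Z'"
    and "dist X Y = 1" "dist Y Z = 1" "dist X' Y' = 1" "dist Y' Z' = 1"
  shows "(Y - X) \<bullet> (Z - Y) = (Y' - X') \<bullet> (Z' - Y')"
proof -
  have n: "norm (X - Y) = 1" "norm (Z - Y) = 1" "norm (X' - Y') = 1" "norm (Z' - Y') = 1"
    using assms(2-) by (simp_all add: dist_norm norm_minus_commute)
  have "\<bar>(X - Y) \<bullet> (Z - Y)\<bar> \<le> 1" "\<bar>(X' - Y') \<bullet> (Z' - Y')\<bar> \<le> 1"
    using Cauchy_Schwarz_ineq2[of "X - Y" "Z - Y"] Cauchy_Schwarz_ineq2[of "X' - Y'" "Z' - Y'"]
    by (simp_all add: n)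
  with assms(1) n have "(X - Y) \<bullet> (Z - Y) = (X' - Y') \<bullet> (Z' - Y')"
    by (simp add: vertex_angle_def arccos_eq_iff)
  then show ?thesis
    by (simp add: inner_diff_left)
qed

text \<open>Equal angles make the cosine \<open>c\<close> of the turn from one side to the next constant, and
  convexity makes the direction of the turn, hence its sine \<open>k\<close>, constant too. The sides add up
  to zero, and the component along \<open>DE\<close> of that sum is \<open>1 + 2 * c + 2 * (c\<^sup>2 - k\<^sup>2)\<close>. As
  \<open>k\<^sup>2 = 1 - c\<^sup>2\<close>, this is a quadratic equation for \<open>c\<close>, whose roots belong to the pentagon and
  the pentagram. The pentagram has \<open>F\<close> and \<open>G\<close> on opposite sides of the line \<open>DE\<close>. Once
  \<open>c\<close> is known, \<open>F - H\<close> is the sum of \<open>DE\<close> and its two neighbours, which are opposite turns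
  of \<open>DE\<close>, so it is \<open>1 + 2 * c\<close> times \<open>DE\<close>.\<close>

lemma unit_regular_pentagon:
  assumes pent: "regular_pentagon D E F G H" and unit: "dist D E = 1"
  shows "F - H = ((1 + sqrt 5) / 2) *\<^sub>R (E - D)"
    and "(wedge (E - D) (F - D))\<^sup>2 = (5 + sqrt 5) / 8"
proof -
  let ?V = "{D, E, F, G, H}"
  have d: "dist D E = 1" "dist E F = 1" "dist F G = 1" "dist G H = 1" "dist H D = 1"
    using pent unit by (auto simp: regular_pentagon_def)
  define u1 u2 u3 u4 u5
    where u_def: "u1 = E - D" "u2 = F - E" "u3 = G - F" "u4 = H - G" "u5 = D - H"
  define c where "c = u1 \<bullet> u2"
  define k where "k = wedge u1 u2"
  have sum0: "u1 + u2 + u3 + u4 + u5 = 0" by (simp add: u_def)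
  have n: "u1 \<bullet> u1 = 1" "u2 \<bullet> u2 = 1" "u3 \<bullet> u3 = 1" "u4 \<bullet> u4 = 1" "u5 \<bullet> u5 = 1"
    using d by (simp_all add: u_def dist_norm norm_minus_commute norm_eq_1[symmetric])
  have ang: "vertex_angle E F G = vertex_angle D E F" "vertex_angle F G H = vertex_angle D E F"
    "vertex_angle G H D = vertex_angle D E F" "vertex_angle H D E = vertex_angle D E F"
    using pent by (auto simp: regular_pentagon_def)
  have cs: "u2 \<bullet> u3 = c" "u3 \<bullet> u4 = c" "u4 \<bullet> u5 = c" "u5 \<bullet> u1 = c"
    unfolding c_def u_def
    by (rule unit_vertex_angle_eq[OF ang(1)] unit_vertex_angle_eq[OF ang(2)]
        unit_vertex_angle_eq[OF ang(3)] unit_vertex_angle_eq[OF ang(4)]; fact d)+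
  have faces: "closed_segment D E face_of convex hull ?V" "closed_segment E F face_of convex hull ?V"
    "closed_segment F G face_of convex hull ?V" "closed_segment G H face_of convex hull ?V"
    using pent by (auto simp: regular_pentagon_def edge_of_def)
  note side = face_segment_same_side[OF faces(1)] face_segment_same_side[OF faces(2)]
    face_segment_same_side[OF faces(3)] face_segment_same_side[OF faces(4)]
  have same: "0 \<le> k * wedge u5 u1" "0 \<le> k * wedge u2 u3"
    "0 \<le> wedge u2 u3 * wedge u3 u4" "0 \<le> wedge u3 u4 * wedge u4 u5"
    using side(1)[of F H] side(2)[of G D] side(3)[of H E] side(4)[of D F]
    by (simp_all add: k_def u_def wedge_def algebra_simps)
  have sq: "c\<^sup>2 + k\<^sup>2 = 1" "c\<^sup>2 + (wedge u2 u3)\<^sup>2 = 1" "c\<^sup>2 + (wedge u3 u4)\<^sup>2 = 1"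
    "c\<^sup>2 + (wedge u4 u5)\<^sup>2 = 1" "c\<^sup>2 + (wedge u5 u1)\<^sup>2 = 1"
    using inner_wedge_pythagoras[of u1 u2] inner_wedge_pythagoras[of u2 u3]
      inner_wedge_pythagoras[of u3 u4] inner_wedge_pythagoras[of u4 u5]
      inner_wedge_pythagoras[of u5 u1]
    by (simp_all add: n cs c_def[symmetric] k_def[symmetric])
  have eqI: "y = x" if "0 \<le> x * y" "c\<^sup>2 + x\<^sup>2 = 1" "c\<^sup>2 + y\<^sup>2 = 1" for x y :: real
  proof -
    have "x\<^sup>2 = y\<^sup>2" using that by simp
    then have "x = y \<or> x = - y" by (simp add: power2_eq_iff)
    then show ?thesis using that(1) by (auto simp: mult_le_0_iff)
  qed
  have k51: "wedge u5 u1 = k" by (rule eqI[OF same(1) sq(1,5)])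
  have k23: "wedge u2 u3 = k" by (rule eqI[OF same(2) sq(1,2)])
  have k34: "wedge u3 u4 = k" using eqI[OF same(3) sq(2,3)] k23 by simp
  have k45: "wedge u4 u5 = k" using eqI[OF same(4) sq(3,4)] k34 by simp
  have u13: "u1 \<bullet> u3 = c\<^sup>2 - k\<^sup>2"
    using inner_angle_add[of u2 u1 u3]
    by (simp add: n cs k23 c_def[symmetric] k_def[symmetric] power2_eq_square)
  have u14: "u4 \<bullet> u1 = c\<^sup>2 - k\<^sup>2"
    using inner_angle_add[of u5 u4 u1] by (simp add: n cs k45 k51 power2_eq_square)
  have "u1 \<bullet> (u1 + u2 + u3 + u4 + u5) = 0" using sum0 by simp
  then have "1 + 2 * c + 2 * (c\<^sup>2 - k\<^sup>2) = 0"
    using cs(4) u14 by (simp add: inner_add_right n u13 c_def[symmetric] inner_commute[of u1 u4]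
        inner_commute[of u1 u5])
  with sq(1) have quad: "4 * c\<^sup>2 + 2 * c - 1 = 0" by simp
  have "(4 * c + 1)\<^sup>2 = 5"
    using quad by (simp add: power2_eq_square algebra_simps)
  then have root: "4 * c + 1 = sqrt 5 \<or> 4 * c + 1 = - sqrt 5"
    by (metis power2_eq_iff real_sqrt_pow2 zero_le_numeral)
  have "k \<noteq> 0"
  proof
    assume "k = 0"
    then have "c\<^sup>2 = 1" using sq(1) by simp
    then have "c = - 3 / 2" using quad by simp
    with \<open>c\<^sup>2 = 1\<close> show False by (simp add: power2_eq_square)
  qed
  have w13: "wedge u1 u3 = 2 * c * k"
    using wedge_angle_add[of u2 u1 u3]
    by (simp add: n cs k23 c_def[symmetric] k_def[symmetric])
  have "0 \<le> wedge u1 u2 * wedge u1 (u1 + u2 + u3)"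
    using side(1)[of F G] by (simp add: u_def wedge_def algebra_simps)
  then have "0 \<le> k\<^sup>2 * (1 + 2 * c)"
    by (simp add: wedge_simps w13 k_def[symmetric] power2_eq_square algebra_simps)
  with \<open>k \<noteq> 0\<close> have "0 \<le> 1 + 2 * c" by (simp add: zero_le_mult_iff)
  moreover have "sqrt 5 > 1" by simp
  ultimately have "4 * c + 1 \<noteq> - sqrt 5" by linarith
  with root have c: "c = (sqrt 5 - 1) / 4" by simp
  have "u2 + u5 = (2 * (u2 \<bullet> u1)) *\<^sub>R u1"
    by (rule opposite_turns_add)
      (simp_all add: n cs c_def inner_commute[of u2 u1] k51 k_def[symmetric] wedge_swap[of u1 u5])
  also have "u2 \<bullet> u1 = c" by (simp add: c_def inner_commute)
  finally have "u2 + u5 = (2 * c) *\<^sub>R u1" .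
  moreover have "F - H = u1 + (u2 + u5)" by (simp add: u_def)
  ultimately have "F - H = (1 + 2 * c) *\<^sub>R u1" by (simp add: scaleR_add_left)
  moreover have "1 + 2 * c = (1 + sqrt 5) / 2" unfolding c by (simp add: field_simps)
  ultimately show "F - H = ((1 + sqrt 5) / 2) *\<^sub>R (E - D)" by (simp only: u_def)
  have "wedge (E - D) (F - D) = k"
    by (simp add: k_def u_def wedge_def algebra_simps)
  moreover have "k\<^sup>2 = 1 - c\<^sup>2" using sq(1) by simp
  moreover have "1 - c\<^sup>2 = (5 + sqrt 5) / 8"
    unfolding c by (simp add: power2_eq_square field_simps)
  ultimately show "(wedge (E - D) (F - D))\<^sup>2 = (5 + sqrt 5) / 8" by simp
qed

lemma pentagon_diagonal_wedge:
  assumes "regular_pentagon D E F G H" and "dist D E = 1"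
  shows "2 * \<bar>wedge (F - H) (F - D)\<bar> = sqrt (5 + 2 * sqrt 5)"
proof -
  note shape = unit_regular_pentagon[OF assms]
  have "(2 * wedge (F - H) (F - D))\<^sup>2 = (1 + sqrt 5)\<^sup>2 * (wedge (E - D) (F - D))\<^sup>2"
    unfolding shape(1) wedge_simps(5) by (simp add: power_mult_distrib)
  also have "\<dots> = 5 + 2 * sqrt 5"
    unfolding shape(2) by (simp add: power2_eq_square field_simps)
  finally have "sqrt (5 + 2 * sqrt 5) = \<bar>2 * wedge (F - H) (F - D)\<bar>"
    by (metis real_sqrt_abs)
  then show ?thesis by (simp add: abs_mult)
qed

section \<open>Enclosing triangles\<close>

lemma triangle_area_ge_if_side_on_base:
  assumes pent: "regular_pentagon D E F G H" and unit: "dist D E = 1"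
    and sub: "convex hull {D, E, F, G, H} \<subseteq> convex hull {P, Q, R}"
    and base: "closed_segment D E \<subseteq> closed_segment P Q"
  shows "sqrt (5 + 2 * sqrt 5) \<le> triangle_area P Q R"
proof -
  have DE: "D \<in> closed_segment P Q" "E \<in> closed_segment P Q"
    using base by auto
  obtain t where "E - D = t *\<^sub>R (Q - P)"
    using DE by (rule diff_on_segment)
  then have par: "F - H = ((1 + sqrt 5) / 2 * t) *\<^sub>R (Q - P)"
    using unit_regular_pentagon(1)[OF pent unit] by simp
  have "{D, E, F, G, H} \<subseteq> convex hull {P, Q, R}"
    using sub hull_subset[of "{D, E, F, G, H}" convex] by blast
  then have "F \<in> convex hull {P, Q, R}" "H \<in> convex hull {P, Q, R}" by auto
  from triangle_area_ge_parallel_chord[OF DE(1) this par] show ?thesis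
    by (simp add: pentagon_diagonal_wedge[OF pent unit])
qed

lemma encloses_area_ge:
  assumes p1: "regular_pentagon D E F G H" and unit: "dist D E = 1"
    and enc: "encloses A B C D E F G H"
  shows "sqrt (5 + 2 * sqrt 5) \<le> triangle_area A B C"
proof -
  note p2 = regular_pentagon_rotate[OF p1]
  note p3 = regular_pentagon_rotate[OF p2(1)]
  note p4 = regular_pentagon_rotate[OF p3(1)]
  note p5 = regular_pentagon_rotate[OF p4(1)]
  have units: "dist E F = 1" "dist F G = 1" "dist G H = 1" "dist H D = 1"
    using unit p2(2) p3(2) p4(2) p5(2) by simp_all
  have rot: "{E, F, G, H, D} = {D, E, F, G, H}" "{F, G, H, D, E} = {D, E, F, G, H}"
    "{G, H, D, E, F} = {D, E, F, G, H}" "{H, D, E, F, G} = {D, E, F, G, H}"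
    by auto
  have any_side: "sqrt (5 + 2 * sqrt 5) \<le> triangle_area P Q R"
    if sub: "convex hull {D, E, F, G, H} \<subseteq> convex hull {P, Q, R}"
      and XY: "(X, Y) \<in> {(D, E), (E, F), (F, G), (G, H), (H, D)}"
      and base: "closed_segment X Y \<subseteq> closed_segment P Q" for P Q R X Y
    using XY base
      triangle_area_ge_if_side_on_base[OF p1 unit sub]
      triangle_area_ge_if_side_on_base[OF p2(1) units(1), of P Q R]
      triangle_area_ge_if_side_on_base[OF p3(1) units(2), of P Q R]
      triangle_area_ge_if_side_on_base[OF p4(1) units(3), of P Q R]
      triangle_area_ge_if_side_on_base[OF p5(1) units(4), of P Q R]
    unfolding rot using sub by blast
  have perm: "{B, C, A} = {A, B, C}" "{C, A, B} = {A, B, C}" by auto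
  have sub: "convex hull {D, E, F, G, H} \<subseteq> convex hull {A, B, C}"
    using enc by (simp add: encloses_def)
  obtain P Q R X Y where PQR: "(P, Q, R) \<in> {(A, B, C), (B, C, A), (C, A, B)}"
      and XY: "(X, Y) \<in> {(D, E), (E, F), (F, G), (G, H), (H, D)}"
      and base: "closed_segment X Y \<subseteq> closed_segment P Q"
    using enc unfolding encloses_def by blast
  have hull: "{P, Q, R} = {A, B, C}"
    using PQR perm by auto
  have "sqrt (5 + 2 * sqrt 5) \<le> triangle_area P Q R"
    by (rule any_side[OF _ XY base]) (use sub hull in simp)
  then show ?thesis
    by (simp add: triangle_area_def hull)
qed

theorem theorem2:
  fixes A B C D E F G H S T :: "real^2"
  assumes "regular_pentagon D E F G H" and "dist D E = 1"
    and "closed_segment S T = reflect_line H F ` closed_segment D E"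
    and "encloses A B C D E F G H"
    and "closed_segment D E \<subseteq> closed_segment A B"
    and "vertex_angle C A B \<le> pi / 2" and "vertex_angle A B C \<le> pi / 2"
    and "F \<in> closed_segment B C" and "H \<in> closed_segment C A"
    and "C \<in> closed_segment S T"
  shows "minimum_enclosing_triangle A B C D E F G H \<and>
         triangle_area A B C = sqrt (5 + 2 * sqrt 5)"
proof -
  note shape = unit_regular_pentagon[OF assms(1,2)]
  have DE: "D \<in> closed_segment A B" "E \<in> closed_segment A B"
    using assms(5) by auto
  obtain t where t: "E - D = t *\<^sub>R (B - A)"
    using DE by (rule diff_on_segment)
  have "E - D \<noteq> 0" using assms(2) by auto
  then have "t \<noteq> 0" using t by auto
  have par: "F - H = ((1 + sqrt 5) / 2 * t) *\<^sub>R (B - A)"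
    using shape(1) t by simp
  have "(wedge (E - D) (F - D))\<^sup>2 > 0"
    unfolding shape(2) by (simp add: add_pos_nonneg)
  then have nz: "wedge (B - A) (F - D) \<noteq> 0"
    unfolding t wedge_simps(5) by simp
  obtain X where X: "X \<in> closed_segment D E" "C = reflect_line H F X"
    using assms(3,10) by auto
  have "X \<in> closed_segment A B" using X(1) assms(5) by blast
  with DE(1) obtain r where "X - D = r *\<^sub>R (B - A)"
    by (rule diff_on_segment)
  then have "wedge (B - A) (X - D) = 0"
    by (simp only: wedge_simps(6,7))
  then have apex: "wedge (B - A) (C - D) = 2 * wedge (B - A) (F - D)"
    unfolding X(2) wedge_reflect_line[OF par] by simp
  have area: "triangle_area A B C = sqrt (5 + 2 * sqrt 5)"
    unfolding triangle_area_midsegment[OF DE(1) assms(8,9) par nz apex]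
    by (rule pentagon_diagonal_wedge[OF assms(1,2)])
  then show ?thesis
    using assms(4) encloses_area_ge[OF assms(1,2)]
    by (auto simp: minimum_enclosing_triangle_def)
qed

end
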